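(* Let $p,q,r,s$ be distinct propositional variables and let $\varphi$ be the formula $$\big((p\circ q)\land r\big)\to\Big(\big((p\land{\sim}s)\circ q\big)\lor\big(p\circ(q\land(s\circ r))\big)\Big).$$ Then $\varphi$ is not a theorem of the Anderson–Belnap system $\mathsf{R}$, but $\varphi$ holds in every relation algebra. In particular, $\mathsf{R}$ is not complete with respect to the class of dense (square-increasing), commutative, integral relation algebras: $\varphi$ holds in all of them but is not a theorem of $\mathsf{R}$.
   Context: Formulas are built from a countable set of propositional variables using the binary connectives $\lor,\land,\to$ and the unary connective $\sim$; fusion is defined by $A\circ B={\sim}(A\to{\sim}B)$. The system $\mathsf{R}$ has as axioms all instances of: $A\to A$; $A\to((A\to B)\to B)$; $(A\to B)\to((B\to C)\to(A\to C))$; $(A\to(A\to B))\to(A\to B)$; $A\land B\to A$; $A\land B\to B$; $(A\to B)\land(A\to C)\to(A\to B\land C)$; $A\to A\lor B$; $B\to A\lor B$; $(A\to C)\land(B\to C)\to(A\lor B\to C)$; $A\land(B\lor C)\to(A\land B)\lor(A\land C)$; $(A\to{\sim}B)\to(B\to{\sim}A)$; ${\sim}{\sim}A\to A$ (where $\sim$ binds tightest, then $\land$, $\lor$, $\to$), and as rules modus ponens (from $A\to B$ and $A$ infer $B$) and adjunction (from $A$ and $B$ infer $A\land B$). A relation algebra is an algebra $\langle U,+,\overline{\phantom{x}},;,\breve{\phantom{x}},1'\rangle$ satisfying Tarski's axioms: $x+y=y+x$; $x+(y+z)=(x+y)+z$; $\overline{\overline{x}+\overline{y}}+\overline{\overline{x}+y}=x$;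 $x;(y;z)=(x;y);z$; $(x+y);z=x;z+y;z$; $x;1'=x$; $\breve{\breve{x}}=x$; $(x+y)\breve{\ }=\breve{x}+\breve{y}$; $(x;y)\breve{\ }=\breve{y};\breve{x}$; $\breve{x};\overline{x;y}+\overline{y}=\overline{y}$. Put $x\cdot y=\overline{\overline{x}+\overline{y}}$, and $x\le y$ iff $x+y=y$. It is commutative if $x;y=y;x$, dense (square-increasing) if $x\le x;x$, and integral if $1'$ is an atom. Given an assignment $h$ of propositional variables to elements of a relation algebra, extend $h$ to all formulas by $h(A\lor B)=h(A)+h(B)$, $h(A\land B)=h(A)\cdot h(B)$, $h({\sim}A)=\overline{h(A)\breve{\ }}$, $h(A\to B)=\overline{h(A)\breve{\ };\overline{h(B)}}$ (so that $h(A\circ B)=h(B);h(A)$). A formula $A$ holds in the relation algebra if $1'\le h(A)$ for every assignment $h$. *)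

theory Defs
  imports Main
begin

datatype fm =
    Var nat
  | Or fm fm   (infixr "\<^bold>\<or>" 130)
  | And fm fm  (infixr "\<^bold>\<and>" 135)
  | Imp fm fm  (infixr "\<^bold>\<rightarrow>" 125)
  | Neg fm     ("\<^bold>\<sim>_" [140] 140)

abbreviation fusion :: "fm \<Rightarrow> fm \<Rightarrow> fm"  (infixr "\<^bold>\<circ>" 137)
  where "A \<^bold>\<circ> B \<equiv> \<^bold>\<sim>(A \<^bold>\<rightarrow> \<^bold>\<sim>B)"

inductive R_theorem :: "fm \<Rightarrow> bool" where
  self_implication: "R_theorem (A \<^bold>\<rightarrow> A)"
| assertion: "R_theorem (A \<^bold>\<rightarrow> ((A \<^bold>\<rightarrow> B) \<^bold>\<rightarrow> B))"
| suffixing: "R_theorem ((A \<^bold>\<rightarrow> B) \<^bold>\<rightarrow> ((B \<^bold>\<rightarrow> C) \<^bold>\<rightarrow> (A \<^bold>\<rightarrow> C)))"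
| contraction: "R_theorem ((A \<^bold>\<rightarrow> (A \<^bold>\<rightarrow> B)) \<^bold>\<rightarrow> (A \<^bold>\<rightarrow> B))"
| and_elim1: "R_theorem ((A \<^bold>\<and> B) \<^bold>\<rightarrow> A)"
| and_elim2: "R_theorem ((A \<^bold>\<and> B) \<^bold>\<rightarrow> B)"
| and_intro: "R_theorem (((A \<^bold>\<rightarrow> B) \<^bold>\<and> (A \<^bold>\<rightarrow> C)) \<^bold>\<rightarrow> (A \<^bold>\<rightarrow> (B \<^bold>\<and> C)))"
| or_intro1: "R_theorem (A \<^bold>\<rightarrow> (A \<^bold>\<or> B))"
| or_intro2: "R_theorem (B \<^bold>\<rightarrow> (A \<^bold>\<or> B))"
| or_elim: "R_theorem (((A \<^bold>\<rightarrow> C) \<^bold>\<and> (B \<^bold>\<rightarrow> C)) \<^bold>\<rightarrow> ((A \<^bold>\<or> B) \<^bold>\<rightarrow> C))"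
| distribution: "R_theorem ((A \<^bold>\<and> (B \<^bold>\<or> C)) \<^bold>\<rightarrow> ((A \<^bold>\<and> B) \<^bold>\<or> (A \<^bold>\<and> C)))"
| contraposition: "R_theorem ((A \<^bold>\<rightarrow> \<^bold>\<sim>B) \<^bold>\<rightarrow> (B \<^bold>\<rightarrow> \<^bold>\<sim>A))"
| double_negation: "R_theorem (\<^bold>\<sim>(\<^bold>\<sim>A) \<^bold>\<rightarrow> A)"
| modus_ponens: "R_theorem (A \<^bold>\<rightarrow> B) \<Longrightarrow> R_theorem A \<Longrightarrow> R_theorem B"
| adjunction: "R_theorem A \<Longrightarrow> R_theorem B \<Longrightarrow> R_theorem (A \<^bold>\<and> B)"

record 'u rel_alg =
  univ :: "'u set"
  join :: "'u \<Rightarrow> 'u \<Rightarrow> 'u"  (infixl "\<oplus>\<index>" 65)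
  cmpl :: "'u \<Rightarrow> 'u"  ("\<ominus>\<index> _" [81] 80)
  rmul :: "'u \<Rightarrow> 'u \<Rightarrow> 'u"  (infixl "\<odot>\<index>" 70)
  conv :: "'u \<Rightarrow> 'u"  ("conv\<index> _" [81] 80)
  ident :: "'u"  ("\<one>\<index>")

definition meet :: "('u, 'm) rel_alg_scheme \<Rightarrow> 'u \<Rightarrow> 'u \<Rightarrow> 'u"  (infixl "\<sqinter>\<index>" 70)
  where "x \<sqinter>\<^bsub>\<UU>\<^esub> y = \<ominus>\<^bsub>\<UU>\<^esub> (\<ominus>\<^bsub>\<UU>\<^esub> x \<oplus>\<^bsub>\<UU>\<^esub> \<ominus>\<^bsub>\<UU>\<^esub> y)"

definition below :: "('u, 'm) rel_alg_scheme \<Rightarrow> 'u \<Rightarrow> 'u \<Rightarrow> bool"  (infix "\<sqsubseteq>\<index>" 50)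
  where "x \<sqsubseteq>\<^bsub>\<UU>\<^esub> y \<longleftrightarrow> x \<oplus>\<^bsub>\<UU>\<^esub> y = y"

(* The signature has no constant for the least element; x + -x is the top element for any x. *)
definition zero :: "('u, 'm) rel_alg_scheme \<Rightarrow> 'u"  ("\<zero>\<index>")
  where "\<zero>\<^bsub>\<UU>\<^esub> = \<ominus>\<^bsub>\<UU>\<^esub> (\<one>\<^bsub>\<UU>\<^esub> \<oplus>\<^bsub>\<UU>\<^esub> \<ominus>\<^bsub>\<UU>\<^esub> \<one>\<^bsub>\<UU>\<^esub>)"

locale relation_algebra =
  fixes \<UU> :: "('u, 'm) rel_alg_scheme" (structure)
  assumes join_closed: "x \<in> univ \<UU> \<Longrightarrow> y \<in> univ \<UU> \<Longrightarrow> x \<oplus> y \<in> univ \<UU>"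
    and cmpl_closed: "x \<in> univ \<UU> \<Longrightarrow> \<ominus> x \<in> univ \<UU>"
    and rmul_closed: "x \<in> univ \<UU> \<Longrightarrow> y \<in> univ \<UU> \<Longrightarrow> x \<odot> y \<in> univ \<UU>"
    and conv_closed: "x \<in> univ \<UU> \<Longrightarrow> conv x \<in> univ \<UU>"
    and ident_closed: "\<one> \<in> univ \<UU>"
    and join_comm: "x \<in> univ \<UU> \<Longrightarrow> y \<in> univ \<UU> \<Longrightarrow> x \<oplus> y = y \<oplus> x"
    and join_assoc: "x \<in> univ \<UU> \<Longrightarrow> y \<in> univ \<UU> \<Longrightarrow> z \<in> univ \<UU> \<Longrightarrow>
      x \<oplus> (y \<oplus> z) = (x \<oplus> y) \<oplus> z"
    and huntington: "x \<in> univ \<UU> \<Longrightarrow> y \<in> univ \<UU> \<Longrightarrow>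
      \<ominus> (\<ominus> x \<oplus> \<ominus> y) \<oplus> \<ominus> (\<ominus> x \<oplus> y) = x"
    and rmul_assoc: "x \<in> univ \<UU> \<Longrightarrow> y \<in> univ \<UU> \<Longrightarrow> z \<in> univ \<UU> \<Longrightarrow>
      x \<odot> (y \<odot> z) = (x \<odot> y) \<odot> z"
    and rmul_distrib: "x \<in> univ \<UU> \<Longrightarrow> y \<in> univ \<UU> \<Longrightarrow> z \<in> univ \<UU> \<Longrightarrow>
      (x \<oplus> y) \<odot> z = x \<odot> z \<oplus> y \<odot> z"
    and rmul_ident: "x \<in> univ \<UU> \<Longrightarrow> x \<odot> \<one> = x"
    and conv_conv: "x \<in> univ \<UU> \<Longrightarrow> conv (conv x) = x"
    and conv_join: "x \<in> univ \<UU> \<Longrightarrow> y \<in> univ \<UU> \<Longrightarrow> conv (x \<oplus> y) = conv x \<oplus> conv y"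
    and conv_rmul: "x \<in> univ \<UU> \<Longrightarrow> y \<in> univ \<UU> \<Longrightarrow> conv (x \<odot> y) = conv y \<odot> conv x"
    and tarski: "x \<in> univ \<UU> \<Longrightarrow> y \<in> univ \<UU> \<Longrightarrow>
      conv x \<odot> (\<ominus> (x \<odot> y)) \<oplus> \<ominus> y = \<ominus> y"

definition commutative_ra :: "('u, 'm) rel_alg_scheme \<Rightarrow> bool"
  where "commutative_ra \<UU> \<longleftrightarrow>
    (\<forall>x \<in> univ \<UU>. \<forall>y \<in> univ \<UU>. x \<odot>\<^bsub>\<UU>\<^esub> y = y \<odot>\<^bsub>\<UU>\<^esub> x)"

definition dense_ra :: "('u, 'm) rel_alg_scheme \<Rightarrow> bool"
  where "dense_ra \<UU> \<longleftrightarrow> (\<forall>x \<in> univ \<UU>. x \<sqsubseteq>\<^bsub>\<UU>\<^esub> x \<odot>\<^bsub>\<UU>\<^esub> x)"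

definition integral_ra :: "('u, 'm) rel_alg_scheme \<Rightarrow> bool"
  where "integral_ra \<UU> \<longleftrightarrow> \<one>\<^bsub>\<UU>\<^esub> \<noteq> \<zero>\<^bsub>\<UU>\<^esub> \<and>
    (\<forall>x \<in> univ \<UU>. x \<sqsubseteq>\<^bsub>\<UU>\<^esub> \<one>\<^bsub>\<UU>\<^esub> \<longrightarrow> x = \<zero>\<^bsub>\<UU>\<^esub> \<or> x = \<one>\<^bsub>\<UU>\<^esub>)"

primrec eval_fm :: "('u, 'm) rel_alg_scheme \<Rightarrow> (nat \<Rightarrow> 'u) \<Rightarrow> fm \<Rightarrow> 'u" where
  "eval_fm \<UU> h (Var v) = h v"
| "eval_fm \<UU> h (A \<^bold>\<or> B) = eval_fm \<UU> h A \<oplus>\<^bsub>\<UU>\<^esub> eval_fm \<UU> h B"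
| "eval_fm \<UU> h (A \<^bold>\<and> B) = eval_fm \<UU> h A \<sqinter>\<^bsub>\<UU>\<^esub> eval_fm \<UU> h B"
| "eval_fm \<UU> h (A \<^bold>\<rightarrow> B) =
     \<ominus>\<^bsub>\<UU>\<^esub> ((conv\<^bsub>\<UU>\<^esub> (eval_fm \<UU> h A)) \<odot>\<^bsub>\<UU>\<^esub> (\<ominus>\<^bsub>\<UU>\<^esub> (eval_fm \<UU> h B)))"
| "eval_fm \<UU> h (\<^bold>\<sim>A) = \<ominus>\<^bsub>\<UU>\<^esub> (conv\<^bsub>\<UU>\<^esub> (eval_fm \<UU> h A))"

definition holds_in :: "fm \<Rightarrow> ('u, 'm) rel_alg_scheme \<Rightarrow> bool"
  where "holds_in A \<UU> \<longleftrightarrow>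
    (\<forall>h. (\<forall>v. h v \<in> univ \<UU>) \<longrightarrow> \<one>\<^bsub>\<UU>\<^esub> \<sqsubseteq>\<^bsub>\<UU>\<^esub> eval_fm \<UU> h A)"

(* K collects algebras whose universes are subsets of one type; the type is left free. *)
definition R_complete_wrt :: "('u, 'm) rel_alg_scheme set \<Rightarrow> bool"
  where "R_complete_wrt K \<longleftrightarrow> (\<forall>A. (\<forall>\<UU> \<in> K. holds_in A \<UU>) \<longrightarrow> R_theorem A)"

definition dense_comm_integral_ras :: "'u rel_alg set"
  where "dense_comm_integral_ras =
    {\<UU>. relation_algebra \<UU> \<and> dense_ra \<UU> \<and> commutative_ra \<UU> \<and> integral_ra \<UU>}"

definition phi :: "nat \<Rightarrow> nat \<Rightarrow> nat \<Rightarrow> nat \<Rightarrow> fm"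
  where "phi p q r s =
    ((Var p \<^bold>\<circ> Var q) \<^bold>\<and> Var r) \<^bold>\<rightarrow>
      (((Var p \<^bold>\<and> \<^bold>\<sim>(Var s)) \<^bold>\<circ> Var q) \<^bold>\<or>
       (Var p \<^bold>\<circ> (Var q \<^bold>\<and> (Var s \<^bold>\<circ> Var r))))"

end

theory Submission
  imports Defs
begin

text \<open>
  The two halves of the theorem meet at one property. Read \<open>z \<in> x \<cdot> y\<close> as "\<open>z\<close> occurs in the composite of
  \<open>x\<close> and \<open>y\<close>", and write \<open>x*\<close> for the converse of \<open>x\<close>.  In the atom structure of a relation algebra,
  \<open>z \<in> x \<cdot> y\<close> implies \<open>x \<in> z \<cdot> y*\<close> (one of the Peirce cycles), and \<open>\<phi>\<close> is exactly what this
  implication says about composition: split \<open>p\<close> into a part outside the converse of \<open>s\<close> and a part inside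
  it; a composite of \<open>q\<close> with the first part lies in the first disjunct, and a composite of \<open>q\<close> with
  the second that lands in \<open>r\<close> comes from an element of \<open>q\<close> that already lies in \<open>r ; s\<close>.
  For abstract relation algebras the cycle is replaced by Schroeder's equivalences
  (\<open>schroeder_left\<close>, \<open>schroeder_right\<close>), derived from Tarski's axioms after the Boolean
  laws have been extracted from Huntington's equation; the argument is completed in
  \<open>phi_inequality\<close>.

  The system R, on the other hand, enforces only the weaker cycle \<open>z \<in> x \<cdot> y \<Longrightarrow> y* \<in> x \<cdot> z*\<close>,
  which is contraposition.  In terms of the ternary relation \<open>z* \<in> x \<cdot> y\<close> the weak cycle,
  together with commutativity, means total symmetry in \<open>x, y, z\<close>, while the Peirce
  cycle adds closure under applying \<open>*\<close> to all three arguments.  It is therefore enough to find a frame for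
  R whose symmetric ternary relation is not closed under \<open>*\<close>.  Three worlds suffice: an
  identity \<open>E\<close> and a pair \<open>P, N\<close> interchanged by \<open>*\<close>, where the triple \<open>P, P, P\<close> is admitted and
  \<open>N, N, N\<close> is not.  The theorems of R are true at \<open>E\<close> (\<open>R_sound\<close>), and the missing
  triple is a counterexample to \<open>\<phi>\<close> (\<open>phi_not_R_theorem\<close>).
\<close>

section \<open>A three-world frame for R refuting the formula\<close>

datatype world = E | P | N

fun star :: "world \<Rightarrow> world" where
  "star E = E"
| "star P = N"
| "star N = P"

text \<open>
  Up to permutation, the triples \<open>x, y, z\<close> with \<open>star z \<in> prod x y\<close> are \<open>E, E, E\<close> and \<open>E, P, N\<close>
  (forced by the identity), \<open>P, P, N\<close> and \<open>P, N, N\<close> (forced by contraction), and \<open>P, P, P\<close>.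
\<close>
fun prod :: "world \<Rightarrow> world \<Rightarrow> world set" where
  "prod E y = {y}"
| "prod x E = {x}"
| "prod P P = {P, N}"
| "prod N N = {N}"
| "prod x y = UNIV"

lemma UNIV_world: "UNIV = {E, P, N}"
  using world.exhaust by auto

lemma star_star: "star (star x) = x"
  by (cases x) auto

lemma prod_comm: "prod x y = prod y x"
  by (cases x; cases y) auto

lemma prod_assoc: "(\<Union>u \<in> prod x y. prod u z) = (\<Union>v \<in> prod y z. prod x v)"
  by (cases x; cases y; cases z) (auto simp: UNIV_world)

lemma prod_idem: "x \<in> prod x x"
  by (cases x) auto

lemma prod_star: "z \<in> prod x y \<Longrightarrow> star y \<in> prod x (star z)"
  by (cases x; cases y; cases z) auto

text \<open>
  Truth sets of the Routley--Meyer semantics.  The heredity order of the frame is equality, so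
  truth sets are arbitrary sets of worlds.
\<close>
primrec sat :: "(nat \<Rightarrow> world set) \<Rightarrow> fm \<Rightarrow> world set" where
  "sat V (Var v) = V v"
| "sat V (A \<^bold>\<or> B) = sat V A \<union> sat V B"
| "sat V (A \<^bold>\<and> B) = sat V A \<inter> sat V B"
| "sat V (A \<^bold>\<rightarrow> B) = {x. \<forall>y \<in> sat V A. prod x y \<subseteq> sat V B}"
| "sat V (\<^bold>\<sim>A) = {x. star x \<notin> sat V A}"

lemma E_sat_Imp: "E \<in> sat V (A \<^bold>\<rightarrow> B) \<longleftrightarrow> sat V A \<subseteq> sat V B"
  by auto

text \<open>
  Each structural axiom of R uses one frame property: assertion uses commutativity, suffixing
  associativity and commutativity, contraction \<open>prod_idem\<close> and associativity, and contraposition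
  \<open>prod_star\<close>.
\<close>
lemma R_sound: "R_theorem A \<Longrightarrow> E \<in> sat V A"
proof (induction rule: R_theorem.induct)
  case (assertion A B)
  show ?case unfolding E_sat_Imp using prod_comm by fastforce
next
  case (suffixing A B C)
  have "w \<in> sat V C"
    if x: "x \<in> sat V (A \<^bold>\<rightarrow> B)" and y: "y \<in> sat V (B \<^bold>\<rightarrow> C)" and u: "u \<in> prod x y"
      and z: "z \<in> sat V A" and w: "w \<in> prod u z" for x y u z w
  proof -
    have "w \<in> (\<Union>u \<in> prod y x. prod u z)"
      using u w prod_comm by blast
    then obtain v where "v \<in> prod x z" "w \<in> prod y v"
      unfolding prod_assoc by blast
    then show ?thesis using x y z by auto
  qed
  then show ?case unfolding E_sat_Imp by fastforce
next
  case (contraction A B)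
  have "w \<in> sat V B"
    if x: "x \<in> sat V (A \<^bold>\<rightarrow> (A \<^bold>\<rightarrow> B))" and y: "y \<in> sat V A" and w: "w \<in> prod x y" for x y w
  proof -
    have "w \<in> (\<Union>v \<in> prod y y. prod x v)"
      using w prod_idem by blast
    then obtain u where "u \<in> prod x y" "w \<in> prod u y"
      unfolding prod_assoc[symmetric] by blast
    then show ?thesis using x y by auto
  qed
  then show ?case unfolding E_sat_Imp by fastforce
next
  case (contraposition A B)
  show ?case unfolding E_sat_Imp using prod_star star_star by fastforce
next
  case (double_negation A)
  show ?case unfolding E_sat_Imp by (simp add: star_star)
qed (auto simp: E_sat_Imp simp del: sat.simps(4), auto)

text \<open>
  With \<open>p = q = {P}\<close> and \<open>r = s = {N}\<close>, the world \<open>N \<in> prod P P\<close> satisfies the antecedent.  It satisfies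
  neither disjunct: \<open>star P = N\<close> falsifies \<open>p \<and> \<sim>s\<close> at \<open>P\<close>, and \<open>P \<notin> prod N N\<close> falsifies
  \<open>q \<and> (s \<circ> r)\<close>.
\<close>
lemma phi_not_R_theorem:
  assumes "distinct [p, q, r, s]"
  shows "\<not> R_theorem (phi p q r s)"
proof
  assume "R_theorem (phi p q r s)"
  define V where "V v = (if v = p \<or> v = q then {P} else {N})" for v
  have V: "V p = {P}" "V q = {P}" "V r = {N}" "V s = {N}"
    using assms by (auto simp: V_def)
  have "E \<in> sat V (phi p q r s)"
    by (rule R_sound) fact
  then show False
    unfolding phi_def E_sat_Imp
    by (auto simp: V dest!: subsetD[where c = N] split: if_splits)
qed

section \<open>Boolean laws from Huntington's equation\<close>

context relation_algebra
begin

lemmas closed [simp] =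
  join_closed cmpl_closed rmul_closed conv_closed ident_closed

lemma join_left_comm:
  "x \<in> univ \<UU> \<Longrightarrow> y \<in> univ \<UU> \<Longrightarrow> z \<in> univ \<UU> \<Longrightarrow> x \<oplus> (y \<oplus> z) = y \<oplus> (x \<oplus> z)"
  by (metis join_assoc join_comm)

lemmas join_ac = join_assoc[symmetric] join_comm join_left_comm

text \<open>Expanding \<open>x\<close> and \<open>-x\<close> along \<open>-y\<close>, and \<open>y\<close> and \<open>-y\<close> along \<open>-x\<close>, gives the same four terms.\<close>
lemma join_cmpl_unique:
  assumes x: "x \<in> univ \<UU>" and y: "y \<in> univ \<UU>"
  shows "x \<oplus> \<ominus> x = y \<oplus> \<ominus> y"
proof -
  have expand: "u \<oplus> \<ominus> u =
      (\<ominus> (\<ominus> u \<oplus> \<ominus> (\<ominus> v)) \<oplus> \<ominus> (\<ominus> u \<oplus> \<ominus> v)) \<oplus> (\<ominus> (\<ominus> (\<ominus> u) \<oplus> \<ominus> (\<ominus> v)) \<oplus> \<ominus> (\<ominus> (\<ominus> u) \<oplus> \<ominus> v))"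
    if "u \<in> univ \<UU>" "v \<in> univ \<UU>" for u v
    using huntington[of u "\<ominus> v"] huntington[of "\<ominus> u" "\<ominus> v"] that by simp
  show ?thesis
    unfolding expand[OF x y] expand[OF y x] using x y by (simp add: join_ac)
qed

lemma cmpl_cmpl [simp]:
  assumes x: "x \<in> univ \<UU>"
  shows "\<ominus> (\<ominus> x) = x"
proof -
  have "\<ominus> (\<ominus> (\<ominus> (\<ominus> x)) \<oplus> \<ominus> (\<ominus> x)) = \<ominus> (\<ominus> x \<oplus> \<ominus> (\<ominus> x))"
    using join_cmpl_unique[of "\<ominus> (\<ominus> x)" "\<ominus> x"] x by (simp add: join_comm)
  then show ?thesis
    using huntington[of x "\<ominus> (\<ominus> x)"] huntington[of "\<ominus> (\<ominus> x)" "\<ominus> x"] x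
    by (metis closed(2) join_comm join_closed)
qed

lemma zero_closed [simp]: "\<zero> \<in> univ \<UU>"
  by (simp add: zero_def)

lemma zero_eq: "x \<in> univ \<UU> \<Longrightarrow> \<ominus> (x \<oplus> \<ominus> x) = \<zero>"
  unfolding zero_def by (metis ident_closed join_cmpl_unique)

lemma cmpl_zero: "x \<in> univ \<UU> \<Longrightarrow> \<ominus> \<zero> = x \<oplus> \<ominus> x"
  using zero_eq[of x] by (metis cmpl_cmpl closed(1,2))

text \<open>
  Huntington's equation with \<open>y = x\<close> gives \<open>x = -(-x + -x) + 0\<close>.  Hence both laws follow once they
  are known for the constants, that is, once \<open>1 + 1 = 1\<close> and therefore \<open>0 + 0 = 0\<close>.
\<close>
lemma
  assumes x: "x \<in> univ \<UU>"
  shows join_zero: "x \<oplus> \<zero> = x" and join_idem: "x \<oplus> x = x"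
proof -
  let ?t = "\<ominus> \<zero>"
  have t: "?t \<in> univ \<UU>" by simp
  have split: "\<ominus> (\<ominus> y \<oplus> \<ominus> y) \<oplus> \<zero> = y" if "y \<in> univ \<UU>" for y
    using huntington[of y y] zero_eq[of y] that by (simp add: join_comm)
  have t0: "?t \<oplus> \<zero> = ?t"
    using cmpl_zero[of "?t"] by simp
  have s: "\<ominus> (?t \<oplus> ?t) \<oplus> \<zero> = \<zero>"
    using split[of \<zero>] by simp
  have "?t \<oplus> \<ominus> (?t \<oplus> ?t) = ?t"
    using s t0 by (smt (verit) closed(1,2) join_assoc join_comm zero_closed)
  then have "?t \<oplus> ?t = (?t \<oplus> ?t) \<oplus> \<ominus> (?t \<oplus> ?t)"
    by (metis closed(1,2) join_assoc zero_closed)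
  also have "\<dots> = ?t"
    using cmpl_zero[of "?t \<oplus> ?t"] by simp
  finally have zz: "\<zero> \<oplus> \<zero> = \<zero>"
    using s by simp
  have join0: "y \<oplus> \<zero> = y" if "y \<in> univ \<UU>" for y
    using split[OF that] zz that
    by (metis closed(1,2) join_assoc zero_closed)
  then show "x \<oplus> \<zero> = x" using x by simp
  have "\<ominus> (y \<oplus> y) = \<ominus> y" if "y \<in> univ \<UU>" for y
    using split[of "\<ominus> y"] join0[of "\<ominus> (y \<oplus> y)"] that by simp
  then show "x \<oplus> x = x"
    using x by (metis closed(1) cmpl_cmpl)
qed

lemma meet_closed [simp]: "x \<in> univ \<UU> \<Longrightarrow> y \<in> univ \<UU> \<Longrightarrow> x \<sqinter> y \<in> univ \<UU>"
  by (simp add: meet_def)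

lemma meet_comm: "x \<in> univ \<UU> \<Longrightarrow> y \<in> univ \<UU> \<Longrightarrow> x \<sqinter> y = y \<sqinter> x"
  by (simp add: meet_def join_comm)

lemma meet_split: "x \<in> univ \<UU> \<Longrightarrow> y \<in> univ \<UU> \<Longrightarrow> x \<sqinter> y \<oplus> x \<sqinter> \<ominus> y = x"
  using huntington[of x y] by (simp add: meet_def)

lemma cmpl_join: "x \<in> univ \<UU> \<Longrightarrow> y \<in> univ \<UU> \<Longrightarrow> \<ominus> (x \<oplus> y) = \<ominus> x \<sqinter> \<ominus> y"
  by (simp add: meet_def)

lemma below_trans:
  "x \<sqsubseteq> y \<Longrightarrow> y \<sqsubseteq> z \<Longrightarrow> x \<in> univ \<UU> \<Longrightarrow> y \<in> univ \<UU> \<Longrightarrow> z \<in> univ \<UU> \<Longrightarrow> x \<sqsubseteq> z"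
  unfolding below_def by (metis join_assoc)

lemma below_antisym: "x \<sqsubseteq> y \<Longrightarrow> y \<sqsubseteq> x \<Longrightarrow> x \<in> univ \<UU> \<Longrightarrow> y \<in> univ \<UU> \<Longrightarrow> x = y"
  unfolding below_def by (metis join_comm)

lemma join_upper1: "x \<in> univ \<UU> \<Longrightarrow> y \<in> univ \<UU> \<Longrightarrow> x \<sqsubseteq> x \<oplus> y"
  unfolding below_def by (simp add: join_assoc join_idem)

lemma join_upper2: "x \<in> univ \<UU> \<Longrightarrow> y \<in> univ \<UU> \<Longrightarrow> y \<sqsubseteq> x \<oplus> y"
  by (metis join_comm join_upper1)

lemma join_least:
  "x \<sqsubseteq> z \<Longrightarrow> y \<sqsubseteq> z \<Longrightarrow> x \<in> univ \<UU> \<Longrightarrow> y \<in> univ \<UU> \<Longrightarrow> z \<in> univ \<UU> \<Longrightarrow> x \<oplus> y \<sqsubseteq> z"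
  unfolding below_def by (metis join_assoc)

lemma meet_lower1: "x \<in> univ \<UU> \<Longrightarrow> y \<in> univ \<UU> \<Longrightarrow> x \<sqinter> y \<sqsubseteq> x"
  using join_upper1[of "x \<sqinter> y" "x \<sqinter> \<ominus> y"] by (simp add: meet_split)

lemma meet_lower2: "x \<in> univ \<UU> \<Longrightarrow> y \<in> univ \<UU> \<Longrightarrow> x \<sqinter> y \<sqsubseteq> y"
  by (metis meet_comm meet_lower1)

lemma cmpl_antimono: "x \<sqsubseteq> y \<Longrightarrow> x \<in> univ \<UU> \<Longrightarrow> y \<in> univ \<UU> \<Longrightarrow> \<ominus> y \<sqsubseteq> \<ominus> x"
  by (metis below_def closed(2) cmpl_join meet_lower1)

lemma below_cmpl_swap: "x \<sqsubseteq> \<ominus> y \<Longrightarrow> x \<in> univ \<UU> \<Longrightarrow> y \<in> univ \<UU> \<Longrightarrow> y \<sqsubseteq> \<ominus> x"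
  by (metis closed(2) cmpl_antimono cmpl_cmpl)

lemma meet_greatest:
  assumes "z \<sqsubseteq> x" "z \<sqsubseteq> y" and c: "x \<in> univ \<UU>" "y \<in> univ \<UU>" "z \<in> univ \<UU>"
  shows "z \<sqsubseteq> x \<sqinter> y"
proof -
  have "\<ominus> x \<oplus> \<ominus> y \<sqsubseteq> \<ominus> z"
    using assms by (simp add: join_least cmpl_antimono)
  then show ?thesis
    unfolding meet_def using c by (simp add: below_cmpl_swap)
qed

lemma zero_least: "x \<in> univ \<UU> \<Longrightarrow> \<zero> \<sqsubseteq> x"
  unfolding below_def by (metis join_comm join_zero zero_closed)

lemma below_zero_if:
  assumes "x \<sqsubseteq> y" "x \<sqsubseteq> \<ominus> y" and c: "x \<in> univ \<UU>" "y \<in> univ \<UU>"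
  shows "x = \<zero>"
proof -
  have "y \<sqinter> \<ominus> y = \<zero>"
    using zero_eq[of y] c by (simp add: meet_def join_comm)
  then show ?thesis
    using meet_greatest[OF assms(1,2)] c
    by (simp add: below_antisym zero_least)
qed

lemma below_if_meet_cmpl:
  assumes "x \<sqinter> \<ominus> y = \<zero>" and c: "x \<in> univ \<UU>" "y \<in> univ \<UU>"
  shows "x \<sqsubseteq> y"
  using meet_split[OF c] meet_lower2[OF c] assms by (simp add: join_zero)

lemma meet_below_if:
  assumes le: "x \<sqsubseteq> y \<oplus> \<ominus> z" and c: "x \<in> univ \<UU>" "y \<in> univ \<UU>" "z \<in> univ \<UU>"
  shows "x \<sqinter> z \<sqsubseteq> y"
proof (rule below_if_meet_cmpl)
  let ?w = "x \<sqinter> z \<sqinter> \<ominus> y"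
  have xz: "?w \<sqsubseteq> x \<sqinter> z" and y: "?w \<sqsubseteq> \<ominus> y"
    using c by (simp_all add: meet_lower1 meet_lower2)
  have x: "?w \<sqsubseteq> x" and z: "?w \<sqsubseteq> z"
    using xz c below_trans meet_lower1 meet_lower2 by (meson closed meet_closed)+
  have "?w \<sqsubseteq> \<ominus> y \<sqinter> z"
    using y z c by (simp add: meet_greatest)
  then have "?w \<sqsubseteq> \<ominus> (y \<oplus> \<ominus> z)"
    using c by (simp add: cmpl_join)
  moreover have "?w \<sqsubseteq> y \<oplus> \<ominus> z"
    using x le c by (meson below_trans closed meet_closed)
  ultimately show "?w = \<zero>"
    using below_zero_if c by simp
qed (use c in simp_all)

section \<open>Converse, composition and Schroeder's equivalences\<close>

lemma conv_mono: "x \<sqsubseteq> y \<Longrightarrow> x \<in> univ \<UU> \<Longrightarrow> y \<in> univ \<UU> \<Longrightarrow> conv x \<sqsubseteq> conv y"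
  unfolding below_def by (metis conv_join)

text \<open>
  Converse is an additive involution, so it carries the top element to itself and complements to
  complements; the inequality \<open>ge\<close> and its own converse give the two directions.
\<close>
lemma conv_cmpl:
  assumes x: "x \<in> univ \<UU>"
  shows "conv (\<ominus> x) = \<ominus> (conv x)"
proof -
  have top: "y \<sqsubseteq> z \<oplus> \<ominus> z" if "y \<in> univ \<UU>" "z \<in> univ \<UU>" for y z
    using join_upper1[of y "\<ominus> y"] join_cmpl_unique[of y z] that by simp
  have ge: "\<ominus> (conv y) \<sqsubseteq> conv (\<ominus> y)" if y: "y \<in> univ \<UU>" for y
  proof -
    have "conv (\<ominus> (conv y)) \<sqsubseteq> \<ominus> y \<oplus> \<ominus> (\<ominus> y)"
      by (rule top) (use y in simp_all)
    then have "conv (conv (\<ominus> (conv y))) \<sqsubseteq> conv (\<ominus> y \<oplus> \<ominus> (\<ominus> y))"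
      by (rule conv_mono) (use y in simp_all)
    then have "\<ominus> (conv y) \<sqsubseteq> conv (\<ominus> y) \<oplus> conv y"
      using y by (simp add: conv_conv conv_join)
    then have "\<ominus> (conv y) \<sqinter> \<ominus> (conv y) \<sqsubseteq> conv (\<ominus> y)"
      using y by (intro meet_below_if) simp_all
    then show ?thesis
      using y by (simp add: meet_def join_idem)
  qed
  have "conv (\<ominus> (conv (conv x))) \<sqsubseteq> conv (conv (\<ominus> (conv x)))"
    using ge[of "conv x"] by (rule conv_mono) (use x in simp_all)
  then show ?thesis
    using ge[OF x] x by (simp add: conv_conv below_antisym)
qed

lemma rmul_distrib_left:
  assumes "x \<in> univ \<UU>" "y \<in> univ \<UU>" "z \<in> univ \<UU>"
  shows "x \<odot> (y \<oplus> z) = x \<odot> y \<oplus> x \<odot> z"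
proof -
  have "conv (x \<odot> (y \<oplus> z)) = conv (x \<odot> y \<oplus> x \<odot> z)"
    using assms by (simp add: conv_rmul conv_join rmul_distrib)
  then show ?thesis
    using assms by (metis closed(1,3) conv_conv)
qed

lemma rmul_mono_right:
  "x \<sqsubseteq> y \<Longrightarrow> x \<in> univ \<UU> \<Longrightarrow> y \<in> univ \<UU> \<Longrightarrow> z \<in> univ \<UU> \<Longrightarrow> z \<odot> x \<sqsubseteq> z \<odot> y"
  unfolding below_def by (metis rmul_distrib_left)

lemma schroeder_left:
  assumes le: "x \<odot> y \<sqsubseteq> \<ominus> z" and c: "x \<in> univ \<UU>" "y \<in> univ \<UU>" "z \<in> univ \<UU>"
  shows "conv x \<odot> z \<sqsubseteq> \<ominus> y"
proof -
  have "z \<sqsubseteq> \<ominus> (x \<odot> y)"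
    using le c by (simp add: below_cmpl_swap)
  then have "conv x \<odot> z \<sqsubseteq> conv x \<odot> \<ominus> (x \<odot> y)"
    using c by (simp add: rmul_mono_right)
  moreover have "conv x \<odot> \<ominus> (x \<odot> y) \<sqsubseteq> \<ominus> y"
    using tarski c by (simp add: below_def)
  ultimately show ?thesis
    using c by (meson below_trans closed)
qed

text \<open>The mirror image of \<open>schroeder_left\<close> under converse.\<close>
lemma schroeder_right:
  assumes le: "x \<odot> y \<sqsubseteq> \<ominus> z" and c: "x \<in> univ \<UU>" "y \<in> univ \<UU>" "z \<in> univ \<UU>"
  shows "z \<odot> conv y \<sqsubseteq> \<ominus> x"
proof -
  have "conv (x \<odot> y) \<sqsubseteq> conv (\<ominus> z)"
    using le c by (simp add: conv_mono)
  then have "conv y \<odot> conv x \<sqsubseteq> \<ominus> (conv z)"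
    using c by (simp add: conv_rmul conv_cmpl)
  then have "conv (conv y) \<odot> conv z \<sqsubseteq> \<ominus> (conv x)"
    by (rule schroeder_left) (use c in simp_all)
  then have "conv (conv (conv y) \<odot> conv z) \<sqsubseteq> conv (\<ominus> (conv x))"
    by (rule conv_mono) (use c in simp_all)
  then show ?thesis
    using c by (simp add: conv_rmul conv_conv conv_cmpl)
qed

section \<open>The formula holds in every relation algebra\<close>

lemma ident_below_imp:
  assumes le: "x \<sqsubseteq> y" and c: "x \<in> univ \<UU>" "y \<in> univ \<UU>"
  shows "\<one> \<sqsubseteq> \<ominus> (conv x \<odot> \<ominus> y)"
proof -
  have "x \<odot> \<one> \<sqsubseteq> \<ominus> (\<ominus> y)"
    using le c by (simp add: rmul_ident)
  then have "conv x \<odot> \<ominus> y \<sqsubseteq> \<ominus> \<one>"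
    by (rule schroeder_left) (use c in simp_all)
  then show ?thesis
    using c by (simp add: below_cmpl_swap)
qed

text \<open>
  Both \<open>p\<close> and \<open>q\<close> are split: \<open>p\<close> along the converse of \<open>s\<close>, and \<open>q\<close> along \<open>r ; s\<close>. Of the pieces of
  \<open>q ; p\<close>, only \<open>(q - r ; s) ; (p \<cdot> conv s)\<close> is not below the right-hand side, and it is disjoint from
  \<open>r\<close> by Schroeder's equivalence.
\<close>
lemma phi_inequality:
  assumes c: "p \<in> univ \<UU>" "q \<in> univ \<UU>" "r \<in> univ \<UU>" "s \<in> univ \<UU>"
  shows "(q \<odot> p) \<sqinter> r \<sqsubseteq> q \<odot> (p \<sqinter> \<ominus> (conv s)) \<oplus> (q \<sqinter> (r \<odot> s)) \<odot> p"
proof (rule meet_below_if)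
  let ?a = "q \<odot> (p \<sqinter> \<ominus> (conv s))" and ?b = "(q \<sqinter> (r \<odot> s)) \<odot> p"
  let ?p = "p \<sqinter> conv s" and ?q = "q \<sqinter> \<ominus> (r \<odot> s)"
  have p: "q \<odot> p = q \<odot> ?p \<oplus> ?a"
    using meet_split[of p "conv s"] rmul_distrib_left[of q ?p "p \<sqinter> \<ominus> (conv s)"] c by simp
  have q: "q \<odot> ?p = (q \<sqinter> (r \<odot> s)) \<odot> ?p \<oplus> ?q \<odot> ?p"
    using meet_split[of q "r \<odot> s"] rmul_distrib[of "q \<sqinter> (r \<odot> s)" ?q ?p] c by simp
  have b: "(q \<sqinter> (r \<odot> s)) \<odot> ?p \<sqsubseteq> ?b"
    using c by (simp add: rmul_mono_right meet_lower1)
  have "r \<odot> s \<sqsubseteq> \<ominus> ?q"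
    using c by (simp add: below_cmpl_swap meet_lower2)
  then have "?q \<odot> conv s \<sqsubseteq> \<ominus> r"
    by (rule schroeder_right) (use c in simp_all)
  moreover have "?q \<odot> ?p \<sqsubseteq> ?q \<odot> conv s"
    using c by (simp add: rmul_mono_right meet_lower2)
  ultimately have r: "?q \<odot> ?p \<sqsubseteq> \<ominus> r"
    using c by (meson below_trans closed meet_closed)
  let ?u = "?a \<oplus> ?b \<oplus> \<ominus> r"
  have ab: "?a \<oplus> ?b \<sqsubseteq> ?u" "\<ominus> r \<sqsubseteq> ?u" "?a \<sqsubseteq> ?a \<oplus> ?b" "?b \<sqsubseteq> ?a \<oplus> ?b"
    using c by (simp_all add: join_upper1 join_upper2)
  have "?a \<sqsubseteq> ?u" "(q \<sqinter> (r \<odot> s)) \<odot> ?p \<sqsubseteq> ?u" "?q \<odot> ?p \<sqsubseteq> ?u"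
    using ab b r c by (meson below_trans closed meet_closed)+
  then show "q \<odot> p \<sqsubseteq> ?u"
    unfolding p q using c by (simp add: join_least)
qed (use c in simp_all)

lemma phi_holds: "holds_in (phi p q r s) \<UU>"
  unfolding holds_in_def
proof (intro allI impI)
  fix h :: "nat \<Rightarrow> _"
  assume h: "\<forall>v. h v \<in> univ \<UU>"
  then have "(h q \<odot> h p) \<sqinter> h r \<sqsubseteq>
      h q \<odot> (h p \<sqinter> \<ominus> (conv (h s))) \<oplus> (h q \<sqinter> (h r \<odot> h s)) \<odot> h p"
    by (simp add: phi_inequality)
  then show "\<one> \<sqsubseteq> eval_fm \<UU> h (phi p q r s)"
    using h unfolding phi_def eval_fm.simps(4)[of _ _ "_ \<^bold>\<and> _" "_ \<^bold>\<or> _"]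
    by (intro ident_below_imp) (simp_all add: conv_cmpl conv_rmul conv_conv)
qed

end

theorem mainTheorem7:
  fixes p q r s :: nat
  assumes "distinct [p, q, r, s]"
  shows "\<not> R_theorem (phi p q r s)
    \<and> (\<forall>\<UU> :: 'u rel_alg. relation_algebra \<UU> \<longrightarrow> holds_in (phi p q r s) \<UU>)
    \<and> (\<forall>\<UU> \<in> (dense_comm_integral_ras :: 'u rel_alg set). holds_in (phi p q r s) \<UU>)
    \<and> \<not> R_complete_wrt (dense_comm_integral_ras :: 'u rel_alg set)"
  using phi_not_R_theorem[OF assms] relation_algebra.phi_holds
  unfolding R_complete_wrt_def dense_comm_integral_ras_def by blast

end
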